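(* Let $S_{\boldsymbol{\lambda}}$ be a contractive weighted shift on the directed tree $\mathcal{T}=(V,E)$. Then the limits $$\alpha_u:=\lim_{n\to\infty}\sum_{v\in\mathrm{Chi}^n(u)}\prod_{j=0}^{n-1}\lambda_{\mathrm{par}^j(v)}^2\in[0,1]\qquad(u\in V)$$ exist, and the asymptotic limit $A$ of $S_{\boldsymbol{\lambda}}$ satisfies $Ae_u=\alpha_ue_u$ for every $u\in V$.
   Context: A directed tree $\mathcal{T}=(V,E)$ consists of a non-empty vertex set $V$ and an edge set $E\subseteq V\times V\setminus\{(v,v)\colon v\in V\}$ such that there are no directed circuits, the underlying undirected graph is connected, and each vertex $v$ has at most one parent, i.e. at most one $u$ with $(u,v)\in E$; this $u$ is denoted $\mathrm{par}(v)$. A vertex without a parent is a root; there is at most one. $V^\circ$ is $V$ minus the root if a root exists, and $V^\circ=V$ otherwise. $\mathrm{Chi}(u)=\{v\colon(u,v)\in E\}$; $\mathrm{Chi}(W)=\bigcup_{v\in W}\mathrm{Chi}(v)$, $\mathrm{Chi}^0(W)=W$, $\mathrm{Chi}^{n+1}(W)=\mathrm{Chi}(\mathrm{Chi}^n(W))$, $\mathrm{Chi}^n(u)=\mathrm{Chi}^n(\{u\})$; $\mathrm{par}^k$ is the $k$-fold iterate of $\mathrm{par}$ where defined, $\mathrm{par}^0$ the identity. $\ell^2(V)$ is the complex Hilbert space of square-summable functions on $V$ with orthonormal basis $\{e_u\}_{u\in V}$. Given weights $\boldsymbol{\lambda}=\{\lambda_v\colon v\in V^\circ\}\subseteq(0,\infty)$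 with $\sup_{u\in V}\sum_{v\in\mathrm{Chi}(u)}\lambda_v^2<\infty$, the weighted shift $S_{\boldsymbol{\lambda}}$ on $\mathcal{T}$ is the bounded operator on $\ell^2(V)$ with $S_{\boldsymbol{\lambda}}e_u=\sum_{v\in\mathrm{Chi}(u)}\lambda_ve_v$ (all weights are assumed positive). It is contractive if $\|S_{\boldsymbol{\lambda}}\|\le1$. The asymptotic limit of a contraction $T$ is $A=A_T=\lim_{n\to\infty}T^{*n}T^n$, the limit in the strong operator topology (which exists). *)

theory Defs
  imports "HOL-Analysis.Analysis"
begin

section \<open>Directed trees\<close>

text \<open>
  The vertex set is the universe of the type \<open>'v\<close>, which is non-empty and otherwise arbitrary
  (in particular of any cardinality); the tree is given by its edge set.
\<close>

definition directed_tree :: "('v \<times> 'v) set \<Rightarrow> bool" where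
  "directed_tree E \<longleftrightarrow>
     irrefl E \<and> acyclic E \<and> (\<forall>u v. (u, v) \<in> (E \<union> E\<inverse>)\<^sup>*) \<and>
     (\<forall>u u' v. (u, v) \<in> E \<longrightarrow> (u', v) \<in> E \<longrightarrow> u = u')"

definition is_root :: "('v \<times> 'v) set \<Rightarrow> 'v \<Rightarrow> bool" where
  "is_root E v \<longleftrightarrow> \<not> (\<exists>u. (u, v) \<in> E)"

definition non_roots :: "('v \<times> 'v) set \<Rightarrow> 'v set" where
  "non_roots E = {v. \<not> is_root E v}"

text \<open>The value of \<open>par\<close> at a root is unspecified.\<close>

definition par :: "('v \<times> 'v) set \<Rightarrow> 'v \<Rightarrow> 'v" where
  "par E v = (THE u. (u, v) \<in> E)"

definition Chi :: "('v \<times> 'v) set \<Rightarrow> 'v \<Rightarrow> 'v set" where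
  "Chi E u = {v. (u, v) \<in> E}"

definition Chi_set :: "('v \<times> 'v) set \<Rightarrow> 'v set \<Rightarrow> 'v set" where
  "Chi_set E W = (\<Union>v\<in>W. Chi E v)"

definition Chi_n :: "('v \<times> 'v) set \<Rightarrow> nat \<Rightarrow> 'v \<Rightarrow> 'v set" where
  "Chi_n E n u = (Chi_set E ^^ n) {u}"


section \<open>The Hilbert space of square-summable functions\<close>

typedef 'v ell2 = "{f :: 'v \<Rightarrow> complex. (\<lambda>x. (cmod (f x))\<^sup>2) summable_on UNIV}"
  morphisms ell2_apply Abs_ell2
  by (rule exI[of _ "\<lambda>_. 0"]) simp

setup_lifting type_definition_ell2

lemma ell2_summable_add:
  fixes f g :: "'v \<Rightarrow> complex"
  assumes "(\<lambda>x. (cmod (f x))\<^sup>2) summable_on UNIV" "(\<lambda>x. (cmod (g x))\<^sup>2) summable_on UNIV"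
  shows "(\<lambda>x. (cmod (f x + g x))\<^sup>2) summable_on UNIV"
proof (rule summable_on_comparison_test)
  show "(\<lambda>x. 2 * (cmod (f x))\<^sup>2 + 2 * (cmod (g x))\<^sup>2) summable_on UNIV"
    by (intro summable_on_add summable_on_cmult_right assms)
  show "(cmod (f x + g x))\<^sup>2 \<le> 2 * (cmod (f x))\<^sup>2 + 2 * (cmod (g x))\<^sup>2" for x
  proof -
    have "(cmod (f x + g x))\<^sup>2 \<le> (cmod (f x) + cmod (g x))\<^sup>2"
      by (intro power_mono norm_triangle_ineq) auto
    also have "\<dots> \<le> 2 * (cmod (f x))\<^sup>2 + 2 * (cmod (g x))\<^sup>2"
      using sum_squares_ge_zero[of "cmod (f x) - cmod (g x)" 0]
      by (simp add: power2_eq_square algebra_simps)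
    finally show ?thesis .
  qed
qed auto

lemma ell2_summable_scale:
  fixes f :: "'v \<Rightarrow> complex"
  assumes "(\<lambda>x. (cmod (f x))\<^sup>2) summable_on UNIV"
  shows "(\<lambda>x. (cmod (c * f x))\<^sup>2) summable_on UNIV"
  using summable_on_cmult_right[OF assms, of "(cmod c)\<^sup>2"]
  by (simp add: norm_mult power_mult_distrib)

lemma ell2_summable_mult:
  fixes f g :: "'v \<Rightarrow> complex"
  assumes "(\<lambda>x. (cmod (f x))\<^sup>2) summable_on UNIV" "(\<lambda>x. (cmod (g x))\<^sup>2) summable_on UNIV"
  shows "(\<lambda>x. f x * cnj (g x)) summable_on UNIV"
proof (rule abs_summable_summable, rule summable_on_comparison_test)
  show "(\<lambda>x. (cmod (f x))\<^sup>2 + (cmod (g x))\<^sup>2) summable_on UNIV"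
    by (intro summable_on_add assms)
  show "norm (f x * cnj (g x)) \<le> (cmod (f x))\<^sup>2 + (cmod (g x))\<^sup>2" for x
  proof -
    have "2 * (cmod (f x) * cmod (g x)) \<le> (cmod (f x))\<^sup>2 + (cmod (g x))\<^sup>2"
      using sum_squares_bound[of "cmod (f x)" "cmod (g x)"] by simp
    moreover have "0 \<le> cmod (f x) * cmod (g x)"
      by simp
    ultimately show ?thesis
      unfolding norm_mult complex_mod_cnj by linarith
  qed
qed auto

instantiation ell2 :: (type) real_vector
begin

lift_definition zero_ell2 :: "'v ell2" is "\<lambda>_. 0"
  by simp

lift_definition plus_ell2 :: "'v ell2 \<Rightarrow> 'v ell2 \<Rightarrow> 'v ell2" is "\<lambda>f g x. f x + g x"
  by (rule ell2_summable_add)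

lift_definition uminus_ell2 :: "'v ell2 \<Rightarrow> 'v ell2" is "\<lambda>f x. - f x"
  by simp

lift_definition minus_ell2 :: "'v ell2 \<Rightarrow> 'v ell2 \<Rightarrow> 'v ell2" is "\<lambda>f g x. f x - g x"
  using ell2_summable_add[of _ "\<lambda>x. - h x" for h] by auto

lift_definition scaleR_ell2 :: "real \<Rightarrow> 'v ell2 \<Rightarrow> 'v ell2" is "\<lambda>r f x. complex_of_real r * f x"
  by (rule ell2_summable_scale)

instance
  by standard (transfer; simp add: algebra_simps)+

end

lift_definition scaleC :: "complex \<Rightarrow> 'v ell2 \<Rightarrow> 'v ell2" (infixr \<open>*\<^sub>C\<close> 75) is "\<lambda>c f x. c * f x"
  by (rule ell2_summable_scale)

definition cinner :: "'v ell2 \<Rightarrow> 'v ell2 \<Rightarrow> complex" where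
  "cinner f g = (\<Sum>\<^sub>\<infinity>x. ell2_apply f x * cnj (ell2_apply g x))"

text \<open>
  The underlying real inner product is the real part of the complex one, so that the library's
  norm, topology and bounded operators (over the reals) become available.
\<close>

instantiation ell2 :: (type) real_inner
begin

definition inner_ell2 :: "'v ell2 \<Rightarrow> 'v ell2 \<Rightarrow> real" where
  "inner_ell2 f g = Re (cinner f g)"

definition norm_ell2 :: "'v ell2 \<Rightarrow> real" where
  "norm_ell2 f = sqrt (\<Sum>\<^sub>\<infinity>x. (cmod (ell2_apply f x))\<^sup>2)"

definition dist_ell2 :: "'v ell2 \<Rightarrow> 'v ell2 \<Rightarrow> real" where
  "dist_ell2 f g = norm (f - g)"

definition sgn_ell2 :: "'v ell2 \<Rightarrow> 'v ell2" where
  "sgn_ell2 f = f /\<^sub>R norm f"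

definition uniformity_ell2 :: "('v ell2 \<times> 'v ell2) filter" where
  "uniformity_ell2 = (INF e\<in>{0 <..}. principal {(x, y). dist x y < e})"

definition open_ell2 :: "'v ell2 set \<Rightarrow> bool" where
  "open_ell2 U \<longleftrightarrow> (\<forall>x\<in>U. eventually (\<lambda>(x', y). x' = x \<longrightarrow> y \<in> U) uniformity)"

instance
proof
  have sm: "(\<lambda>x. ell2_apply f x * cnj (ell2_apply g x)) summable_on UNIV" for f g :: "'v ell2"
    using ell2_summable_mult ell2_apply by blast
  have sq: "(\<lambda>x. (cmod (ell2_apply f x))\<^sup>2) summable_on UNIV" for f :: "'v ell2"
    using ell2_apply by blast
  have inner_Re: "inner f g = (\<Sum>\<^sub>\<infinity>x. Re (ell2_apply f x * cnj (ell2_apply g x)))"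
    for f g :: "'v ell2"
    unfolding inner_ell2_def cinner_def by (rule infsum_Re[symmetric, OF sm])
  have Re_sm: "(\<lambda>x. Re (ell2_apply f x * cnj (ell2_apply g x))) summable_on UNIV"
    for f g :: "'v ell2"
    by (rule summable_on_Re[OF sm])
  have inner_self: "inner f f = (\<Sum>\<^sub>\<infinity>x. (cmod (ell2_apply f x))\<^sup>2)" for f :: "'v ell2"
    unfolding inner_Re cmod_power2 by (simp add: power2_eq_square)
  fix f g h :: "'v ell2" and r :: real and U :: "'v ell2 set"
  show "dist f g = norm (f - g)"
    by (rule dist_ell2_def)
  show "sgn f = f /\<^sub>R norm f"
    by (rule sgn_ell2_def)
  show "uniformity = (INF e\<in>{0 <..}. principal {(x, y :: 'v ell2). dist x y < e})"
    by (rule uniformity_ell2_def)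
  show "open U \<longleftrightarrow> (\<forall>x\<in>U. eventually (\<lambda>(x', y). x' = x \<longrightarrow> y \<in> U) uniformity)"
    by (rule open_ell2_def)
  show "inner f g = inner g f"
    unfolding inner_Re by (simp add: mult.commute)
  show "inner (f + g) h = inner f h + inner g h"
    unfolding inner_Re infsum_add[OF Re_sm Re_sm, symmetric]
    by (simp add: plus_ell2.rep_eq algebra_simps)
  show "inner (r *\<^sub>R f) g = r * inner f g"
    unfolding inner_Re infsum_cmult_right'[symmetric]
    by (simp add: scaleR_ell2.rep_eq algebra_simps)
  show "0 \<le> inner f f"
    unfolding inner_self by (rule infsum_nonneg) simp
  show "inner f f = 0 \<longleftrightarrow> f = 0"
  proof
    assume "inner f f = 0"
    then have "(cmod (ell2_apply f x))\<^sup>2 = 0" for x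
      unfolding inner_self by (intro nonneg_infsum_le_0D[OF _ sq]) auto
    then show "f = 0"
      by (intro ell2_apply_inject[THEN iffD1]) (simp add: zero_ell2.rep_eq fun_eq_iff)
  next
    assume "f = 0"
    then show "inner f f = 0"
      unfolding inner_self by (simp add: zero_ell2.rep_eq)
  qed
  show "norm f = sqrt (inner f f)"
    unfolding norm_ell2_def inner_self ..
qed

end

lift_definition ell2_basis :: "'v \<Rightarrow> 'v ell2" is "\<lambda>u x. if x = u then 1 else 0"
proof -
  fix u :: 'v
  have "(\<lambda>x. (cmod (if x = u then 1 else 0))\<^sup>2) summable_on {u}"
    by simp
  then show "(\<lambda>x. (cmod (if x = u then 1 else 0))\<^sup>2) summable_on UNIV"
    by (subst summable_on_cong_neutral[where T = "{u}"]) auto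
qed


section \<open>Bounded operators\<close>

type_synonym 'v operator = "'v ell2 \<Rightarrow>\<^sub>L 'v ell2"

text \<open>Additivity and boundedness are built into \<open>'v operator\<close>.\<close>

definition complex_linear :: "'v operator \<Rightarrow> bool" where
  "complex_linear T \<longleftrightarrow> (\<forall>c f. blinfun_apply T (c *\<^sub>C f) = c *\<^sub>C blinfun_apply T f)"

definition adjoint_op :: "'v operator \<Rightarrow> 'v operator" where
  "adjoint_op T =
     (THE R. \<forall>f g. cinner (blinfun_apply T f) g = cinner f (blinfun_apply R g))"

primrec op_power :: "'v operator \<Rightarrow> nat \<Rightarrow> 'v operator" where
  "op_power T 0 = id_blinfun"
| "op_power T (Suc n) = T o\<^sub>L op_power T n"

definition contraction :: "'v operator \<Rightarrow> bool" where
  "contraction T \<longleftrightarrow> norm T \<le> 1"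

definition asymptotic_limit :: "'v operator \<Rightarrow> 'v operator" where
  "asymptotic_limit T =
     (THE A. limitin strong_operator_topology
               (\<lambda>n. op_power (adjoint_op T) n o\<^sub>L op_power T n) A sequentially)"


section \<open>Weighted shifts\<close>

text \<open>
  Weights are total functions on the vertices, but only their values at non-root vertices matter.
  The supremum is taken in the extended non-negative reals, so that it also accounts for
  vertices whose squared child weights are not summable.
\<close>

definition admissible_weights :: "('v \<times> 'v) set \<Rightarrow> ('v \<Rightarrow> real) \<Rightarrow> bool" where
  "admissible_weights E lam \<longleftrightarrow>
     (\<forall>v \<in> non_roots E. 0 < lam v) \<and>
     (SUP u. \<Sum>\<^sub>\<infinity>v\<in>Chi E u. ennreal ((lam v)\<^sup>2)) < \<infinity>"

definition weighted_shift :: "('v \<times> 'v) set \<Rightarrow> ('v \<Rightarrow> real) \<Rightarrow> 'v operator" where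
  "weighted_shift E lam =
     (THE S. complex_linear S \<and>
        (\<forall>u. blinfun_apply S (ell2_basis u) = (\<Sum>\<^sub>\<infinity>v\<in>Chi E u. lam v *\<^sub>R ell2_basis v)))"

definition path_weight_sq :: "('v \<times> 'v) set \<Rightarrow> ('v \<Rightarrow> real) \<Rightarrow> nat \<Rightarrow> 'v \<Rightarrow> real" where
  "path_weight_sq E lam n v = (\<Prod>j<n. (lam ((par E ^^ j) v))\<^sup>2)"

end

theory Submission
  imports Defs
begin

text \<open>
  The shift \<open>S\<close> acts by \<open>(S f) v = \<lambda>\<^sub>v f (par v)\<close> and its adjoint by
  \<open>(S\<^sup>* g) u = \<Sum>\<^sub>v \<lambda>\<^sub>v g v\<close>, the sum ranging over the children of \<open>u\<close>. Conjugating the diagonal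
  operator with entries \<open>a\<^sub>v\<close> to \<open>S\<^sup>* D S\<close> therefore gives the diagonal operator with entries
  \<open>\<Sum>\<^sub>v \<lambda>\<^sub>v\<^sup>2 a\<^sub>v\<close> at \<open>u\<close>, which is the recursion satisfied by the path sums when a path is split at
  its first edge. So \<open>S\<^sup>*\<^sup>n S\<^sup>n\<close> is diagonal with the path sums as entries. Contractivity means that
  the squared weights of the children of any vertex sum to at most 1; hence the path sums decrease
  in \<open>n\<close> and stay in \<open>[0, 1]\<close>, and bounded diagonal operators converge strongly when their entries
  converge.
\<close>

section \<open>Infinite sums\<close>

text \<open>The Cauchy-Schwarz inequality for infinite sums. The finite inequality bounds every
  finite partial sum by the same constant \<open>sqrt ?C\<close>, so the bound passes to the
  infinite sum. It controls the sum over children that defines the adjoint of the shift.\<close>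

lemma infsum_mult_sq_le:
  fixes a b :: "'a \<Rightarrow> real"
  assumes a: "(\<lambda>x. (a x)\<^sup>2) summable_on A" and b: "(\<lambda>x. (b x)\<^sup>2) summable_on A"
    and nonneg: "\<And>x. x \<in> A \<Longrightarrow> 0 \<le> a x" "\<And>x. x \<in> A \<Longrightarrow> 0 \<le> b x"
  shows "(\<lambda>x. a x * b x) summable_on A"
    and "(\<Sum>\<^sub>\<infinity>x\<in>A. a x * b x)\<^sup>2 \<le> (\<Sum>\<^sub>\<infinity>x\<in>A. (a x)\<^sup>2) * (\<Sum>\<^sub>\<infinity>x\<in>A. (b x)\<^sup>2)"
proof -
  show sm: "(\<lambda>x. a x * b x) summable_on A"
  proof (rule summable_on_comparison_test[OF summable_on_add[OF a b]])
    fix x assume "x \<in> A"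
    then show "0 \<le> a x * b x"
      by (simp add: nonneg)
    then show "a x * b x \<le> (a x)\<^sup>2 + (b x)\<^sup>2"
      using sum_squares_bound[of "a x" "b x"] by linarith
  qed
  let ?C = "(\<Sum>\<^sub>\<infinity>x\<in>A. (a x)\<^sup>2) * (\<Sum>\<^sub>\<infinity>x\<in>A. (b x)\<^sup>2)"
  have "(\<Sum>\<^sub>\<infinity>x\<in>A. a x * b x) \<le> sqrt ?C"
  proof (rule infsum_le_finite_sums[OF sm])
    fix F assume F: "finite F" "F \<subseteq> A"
    have "(\<Sum>x\<in>F. a x * b x)\<^sup>2 \<le> (\<Sum>x\<in>F. (a x)\<^sup>2) * (\<Sum>x\<in>F. (b x)\<^sup>2)"
      by (rule Cauchy_Schwarz_ineq_sum)
    also have "\<dots> \<le> ?C"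
      by (intro mult_mono finite_sum_le_infsum a b F infsum_nonneg sum_nonneg) auto
    finally show "(\<Sum>x\<in>F. a x * b x) \<le> sqrt ?C"
      by (rule real_le_rsqrt)
  qed
  moreover have "0 \<le> (\<Sum>\<^sub>\<infinity>x\<in>A. a x * b x)"
    by (intro infsum_nonneg mult_nonneg_nonneg nonneg)
  ultimately have "(\<Sum>\<^sub>\<infinity>x\<in>A. a x * b x)\<^sup>2 \<le> (sqrt ?C)\<^sup>2"
    by (intro power_mono)
  then show "(\<Sum>\<^sub>\<infinity>x\<in>A. a x * b x)\<^sup>2 \<le> ?C"
    by (simp add: infsum_nonneg)
qed

text \<open>No summability hypothesis is imposed: the complex family is summable exactly when the
  real one is, as taking real parts shows, and otherwise both sides are the default value 0.\<close>

lemma infsum_complex_of_real: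
  "(\<Sum>\<^sub>\<infinity>x\<in>A. complex_of_real (f x)) = of_real (\<Sum>\<^sub>\<infinity>x\<in>A. f x)"
proof (cases "f summable_on A")
  case True
  then show ?thesis
    by (intro infsumI) (simp add: has_sum_of_real_iff)
next
  case False
  then have "\<not> (\<lambda>x. complex_of_real (f x)) summable_on A"
    using summable_on_Re by fastforce
  with False show ?thesis
    by (simp add: infsum_not_exists)
qed


section \<open>Square-summable functions\<close>

lemma ell2_square_summable:
  "(\<lambda>x. (cmod (ell2_apply f x))\<^sup>2) summable_on A"
  using ell2_apply[of f] by (auto intro: summable_on_subset_banach)

lemma norm_ell2_sq: "(norm f)\<^sup>2 = (\<Sum>\<^sub>\<infinity>x. (cmod (ell2_apply f x))\<^sup>2)"
  unfolding norm_ell2_def by (simp add: infsum_nonneg)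

lemma ell2_eqI: "(\<And>x. ell2_apply f x = ell2_apply g x) \<Longrightarrow> f = g"
  by (metis ell2_apply_inject ext)

lemma ell2_apply_sum: "ell2_apply (sum f F) x = (\<Sum>i\<in>F. ell2_apply (f i) x)"
  by (induction F rule: infinite_finite_induct) (auto simp: zero_ell2.rep_eq plus_ell2.rep_eq)

lemma cinner_ell2_basis: "cinner (ell2_basis u) g = cnj (ell2_apply g u)"
proof -
  have "cinner (ell2_basis u) g = (\<Sum>\<^sub>\<infinity>x\<in>{u}. cnj (ell2_apply g x))"
    unfolding cinner_def by (rule infsum_cong_neutral) (auto simp: ell2_basis.rep_eq)
  then show ?thesis
    by simp
qed

text \<open>Subtracting the partial sum \<open>p F\<close> from \<open>f\<close> leaves
  \<open>f\<close> restricted to the complement of \<open>F\<close>, so the squared distance is a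
  tail of the convergent sum for the norm of \<open>f\<close>.\<close>

lemma ell2_basis_has_sum:
  "((\<lambda>x. ell2_apply f x *\<^sub>C ell2_basis x) has_sum f) UNIV"
proof -
  define p where "p F = (\<Sum>x\<in>F. ell2_apply f x *\<^sub>C ell2_basis x)" for F
  let ?s = "\<lambda>x. (cmod (ell2_apply f x))\<^sup>2"
  have p_apply: "ell2_apply (p F) x = (if x \<in> F then ell2_apply f x else 0)" if "finite F" for F x
    using that by (simp add: p_def ell2_apply_sum scaleC.rep_eq ell2_basis.rep_eq
        if_distrib[of "\<lambda>y. _ * y"] sum.delta cong: if_cong)
  have norm_p: "norm (f - p F) = sqrt ((\<Sum>\<^sub>\<infinity>x. ?s x) - sum ?s F)" if "finite F" for F
  proof -
    have "(norm (f - p F))\<^sup>2 = (\<Sum>\<^sub>\<infinity>x\<in>UNIV - F. ?s x)"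
      unfolding norm_ell2_sq
      by (rule infsum_cong_neutral) (auto simp: minus_ell2.rep_eq p_apply[OF that])
    also have "\<dots> = (\<Sum>\<^sub>\<infinity>x. ?s x) - sum ?s F"
      using that by (subst infsum_Diff) (auto simp: ell2_square_summable)
    finally show ?thesis
      by (metis norm_ge_zero real_sqrt_abs abs_of_nonneg)
  qed
  have "(sum ?s \<longlongrightarrow> (\<Sum>\<^sub>\<infinity>x. ?s x)) (finite_subsets_at_top UNIV)"
    using has_sum_infsum[OF ell2_square_summable[of f UNIV]] by (simp add: has_sum_def)
  then have "((\<lambda>F. sqrt ((\<Sum>\<^sub>\<infinity>x. ?s x) - sum ?s F)) \<longlongrightarrow> sqrt ((\<Sum>\<^sub>\<infinity>x. ?s x) - (\<Sum>\<^sub>\<infinity>x. ?s x)))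
      (finite_subsets_at_top UNIV)"
    by (intro tendsto_intros)
  moreover have "\<forall>\<^sub>F F in finite_subsets_at_top UNIV.
      sqrt ((\<Sum>\<^sub>\<infinity>x. ?s x) - sum ?s F) = norm (f - p F)"
    by (intro eventually_finite_subsets_at_top_weakI) (simp add: norm_p)
  ultimately have "((\<lambda>F. norm (f - p F)) \<longlongrightarrow> 0) (finite_subsets_at_top UNIV)"
    using Lim_transform_eventually by fastforce
  then have "(p \<longlongrightarrow> f) (finite_subsets_at_top UNIV)"
    by (subst tendsto_dist_iff) (simp add: dist_norm norm_minus_commute)
  then show ?thesis
    by (simp add: has_sum_def p_def[abs_def])
qed

text \<open>A bounded complex-linear operator can be applied termwise to the basis expansion of
  \<open>f\<close>. This gives the uniqueness that the definite description in
  \<open>weighted_shift\<close> requires.\<close>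

lemma complex_linear_eqI_basis:
  fixes S T :: "'a operator"
  assumes "complex_linear S" "complex_linear T"
    and "\<And>u. blinfun_apply S (ell2_basis u) = blinfun_apply T (ell2_basis u)"
  shows "S = T"
proof (rule blinfun_eqI)
  fix f :: "'a ell2"
  have "((\<lambda>x. ell2_apply f x *\<^sub>C blinfun_apply R (ell2_basis x)) has_sum blinfun_apply R f) UNIV"
    if "complex_linear R" for R
    using has_sum_bounded_linear[OF blinfun.bounded_linear_right ell2_basis_has_sum, of R f] that
    by (simp add: complex_linear_def)
  from this[OF assms(1)] this[OF assms(2)] show "blinfun_apply S f = blinfun_apply T f"
    by (auto simp: assms(3) intro: has_sum_unique)
qed

text \<open>Builds an operator from a coordinate formula. Homogeneity is asked for real scalars
  because \<open>operator\<close> is a type of real-linear maps; complex linearity is a separate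
  predicate.\<close>

lemma ex_operator:
  fixes \<Phi> :: "'v ell2 \<Rightarrow> 'v \<Rightarrow> complex"
  assumes add: "\<And>f g x. \<Phi> (f + g) x = \<Phi> f x + \<Phi> g x"
    and scale: "\<And>r f x. \<Phi> (r *\<^sub>R f) x = of_real r * \<Phi> f x"
    and summable: "\<And>f. (\<lambda>x. (cmod (\<Phi> f x))\<^sup>2) summable_on UNIV"
    and bound: "\<And>f. (\<Sum>\<^sub>\<infinity>x. (cmod (\<Phi> f x))\<^sup>2) \<le> K * (norm f)\<^sup>2"
  shows "\<exists>T :: 'v operator. \<forall>f x. ell2_apply (blinfun_apply T f) x = \<Phi> f x"
proof -
  define t where "t f = Abs_ell2 (\<Phi> f)" for f
  have t: "ell2_apply (t f) = \<Phi> f" for f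
    unfolding t_def using summable by (intro Abs_ell2_inverse) simp
  have "bounded_linear t"
  proof (rule bounded_linear_intro)
    show "t (f + g) = t f + t g" for f g
      by (rule ell2_eqI) (simp add: t plus_ell2.rep_eq add)
    show "t (r *\<^sub>R f) = r *\<^sub>R t f" for r f
      by (rule ell2_eqI) (simp add: t scaleR_ell2.rep_eq scale)
    \<comment> \<open>The absolute value allows for the unspecified sign of
      \<open>K\<close>.\<close>
    show "norm (t f) \<le> norm f * sqrt \<bar>K\<bar>" for f
    proof (rule power2_le_imp_le)
      have "(norm (t f))\<^sup>2 \<le> K * (norm f)\<^sup>2"
        using bound by (simp add: norm_ell2_sq t)
      also have "\<dots> \<le> \<bar>K\<bar> * (norm f)\<^sup>2"
        by (simp add: mult_right_mono)
      finally show "(norm (t f))\<^sup>2 \<le> (norm f * sqrt \<bar>K\<bar>)\<^sup>2"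
        by (simp add: power_mult_distrib mult.commute)
    qed simp
  qed
  then show ?thesis
    by (intro exI[of _ "Blinfun t"]) (simp add: bounded_linear_Blinfun_apply t)
qed


section \<open>Diagonal operators\<close>

text \<open>A relation rather than a function of \<open>a\<close>, since an unbounded family of
  entries defines no bounded operator.\<close>

definition diagonal :: "('v \<Rightarrow> real) \<Rightarrow> 'v operator \<Rightarrow> bool" where
  "diagonal a D \<longleftrightarrow> (\<forall>f x. ell2_apply (blinfun_apply D f) x = of_real (a x) * ell2_apply f x)"

lemma ex_diagonal:
  assumes "\<And>x. \<bar>a x\<bar> \<le> K"
  shows "\<exists>D. diagonal a D"
  unfolding diagonal_def
proof (rule ex_operator)
  fix f :: "'a ell2"
  have le: "(cmod (of_real (a x) * ell2_apply f x))\<^sup>2 \<le> K\<^sup>2 * (cmod (ell2_apply f x))\<^sup>2" for x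
    using power_mono[OF assms[of x], of 2]
    by (simp add: norm_mult power_mult_distrib mult_right_mono)
  show sm: "(\<lambda>x. (cmod (of_real (a x) * ell2_apply f x))\<^sup>2) summable_on UNIV"
    by (rule summable_on_comparison_test[OF summable_on_cmult_right[OF ell2_square_summable] le]) auto
  show "(\<Sum>\<^sub>\<infinity>x. (cmod (of_real (a x) * ell2_apply f x))\<^sup>2) \<le> K\<^sup>2 * (norm f)\<^sup>2"
    unfolding norm_ell2_sq infsum_cmult_right'[symmetric]
    by (intro infsum_mono sm summable_on_cmult_right ell2_square_summable le)
qed (auto simp: plus_ell2.rep_eq scaleR_ell2.rep_eq algebra_simps)

lemma diagonal_basis:
  assumes "diagonal a D"
  shows "blinfun_apply D (ell2_basis u) = a u *\<^sub>R ell2_basis u"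
  using assms by (intro ell2_eqI) (auto simp: diagonal_def ell2_basis.rep_eq scaleR_ell2.rep_eq)

text \<open>A dominated convergence argument. The squared distance is a sum of terms dominated,
  uniformly in \<open>n\<close>, by a summable family; a finite set carries all but
  \<open>e / 2\<close> of the dominating sum, and on that set entrywise convergence
  suffices.\<close>

lemma diagonal_tendsto:
  assumes D: "\<And>n. diagonal (a n) (D n)" and A: "diagonal \<alpha> A"
    and bound: "\<And>n x. \<bar>a n x - \<alpha> x\<bar> \<le> K"
    and lim: "\<And>x. (\<lambda>n. a n x) \<longlonglongrightarrow> \<alpha> x"
  shows "(\<lambda>n. blinfun_apply (D n) f) \<longlonglongrightarrow> blinfun_apply A f"
proof -
  define s where "s n x = (a n x - \<alpha> x)\<^sup>2 * (cmod (ell2_apply f x))\<^sup>2" for n x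
  have norm_eq: "(norm (blinfun_apply (D n) f - blinfun_apply A f))\<^sup>2 = (\<Sum>\<^sub>\<infinity>x. s n x)" for n
  proof -
    have "cmod (of_real (a n x) * z - of_real (\<alpha> x) * z) = \<bar>a n x - \<alpha> x\<bar> * cmod z" for x z
      by (metis left_diff_distrib norm_mult norm_of_real of_real_diff)
    then show ?thesis
      using D[of n] A unfolding norm_ell2_sq s_def diagonal_def minus_ell2.rep_eq
      by (simp add: power_mult_distrib)
  qed
  have s_le: "s n x \<le> K\<^sup>2 * (cmod (ell2_apply f x))\<^sup>2" for n x
    using power_mono[OF bound[of n x], of 2] by (simp add: s_def mult_right_mono)
  have f_sm: "(\<lambda>x. K\<^sup>2 * (cmod (ell2_apply f x))\<^sup>2) summable_on B" for B
    by (intro summable_on_cmult_right ell2_square_summable)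
  have s_sm: "s n summable_on B" for n B
    by (rule summable_on_comparison_test[OF f_sm s_le]) (auto simp: s_def)
  have "(\<lambda>n. \<Sum>\<^sub>\<infinity>x. s n x) \<longlonglongrightarrow> 0"
  proof (rule LIMSEQ_I)
    fix e :: real assume "e > 0"
    let ?M = "\<Sum>\<^sub>\<infinity>x. K\<^sup>2 * (cmod (ell2_apply f x))\<^sup>2"
    have "(sum (\<lambda>x. K\<^sup>2 * (cmod (ell2_apply f x))\<^sup>2) \<longlongrightarrow> ?M) (finite_subsets_at_top UNIV)"
      using has_sum_infsum[OF f_sm[of UNIV]] by (simp add: has_sum_def)
    then have "\<forall>\<^sub>F F in finite_subsets_at_top UNIV.
        dist (sum (\<lambda>x. K\<^sup>2 * (cmod (ell2_apply f x))\<^sup>2) F) ?M < e / 2"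
      using \<open>e > 0\<close> by (intro tendstoD) auto
    then obtain F where F: "finite F"
      "dist (sum (\<lambda>x. K\<^sup>2 * (cmod (ell2_apply f x))\<^sup>2) F) ?M < e / 2"
      unfolding eventually_finite_subsets_at_top by auto
    \<comment> \<open>\<open>F\<close> was chosen from the dominating family alone, so this bound
      holds for all \<open>n\<close> at once.\<close>
    have tail: "(\<Sum>\<^sub>\<infinity>x\<in>UNIV - F. s n x) < e / 2" for n
    proof -
      have "(\<Sum>\<^sub>\<infinity>x\<in>UNIV - F. s n x) \<le> (\<Sum>\<^sub>\<infinity>x\<in>UNIV - F. K\<^sup>2 * (cmod (ell2_apply f x))\<^sup>2)"
        by (intro infsum_mono s_sm f_sm s_le)
      also have "\<dots> = ?M - sum (\<lambda>x. K\<^sup>2 * (cmod (ell2_apply f x))\<^sup>2) F"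
        using F by (subst infsum_Diff) (auto intro: f_sm)
      finally show ?thesis
        using F(2) unfolding dist_real_def by linarith
    qed
    have "(\<lambda>n. sum (s n) F) \<longlonglongrightarrow> (\<Sum>x\<in>F. (\<alpha> x - \<alpha> x)\<^sup>2 * (cmod (ell2_apply f x))\<^sup>2)"
      unfolding s_def by (intro tendsto_intros lim)
    then have "(\<lambda>n. sum (s n) F) \<longlonglongrightarrow> 0"
      by simp
    from LIMSEQ_D[OF this, of "e / 2"] \<open>e > 0\<close>
    obtain N where N: "\<And>n. n \<ge> N \<Longrightarrow> \<bar>sum (s n) F\<bar> < e / 2"
      by auto
    have "norm ((\<Sum>\<^sub>\<infinity>x. s n x) - 0) < e" if "n \<ge> N" for n
    proof -
      have "(\<Sum>\<^sub>\<infinity>x\<in>UNIV - F. s n x) = (\<Sum>\<^sub>\<infinity>x. s n x) - sum (s n) F"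
        using F by (subst infsum_Diff) (auto intro: s_sm)
      moreover have "0 \<le> (\<Sum>\<^sub>\<infinity>x. s n x)"
        by (rule infsum_nonneg) (simp add: s_def)
      ultimately show ?thesis
        using tail[of n] N[OF that] by auto
    qed
    then show "\<exists>N. \<forall>n\<ge>N. norm ((\<Sum>\<^sub>\<infinity>x. s n x) - 0) < e"
      by blast
  qed
  then have "(\<lambda>n. sqrt ((norm (blinfun_apply (D n) f - blinfun_apply A f))\<^sup>2)) \<longlonglongrightarrow> sqrt 0"
    unfolding norm_eq by (rule tendsto_real_sqrt)
  then show ?thesis
    by (subst tendsto_dist_iff) (simp add: dist_norm)
qed


section \<open>Adjoints and strong limits\<close>

text \<open>Pairing with basis vectors reads off coordinates, so a candidate satisfying the adjoint
  relation is the only one, and the definite description picks it.\<close>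

lemma adjoint_op_eqI:
  assumes "\<And>f g. cinner (blinfun_apply T f) g = cinner f (blinfun_apply R g)"
  shows "adjoint_op T = R"
  unfolding adjoint_op_def
proof (rule the_equality)
  fix R'
  assume R': "\<forall>f g. cinner (blinfun_apply T f) g = cinner f (blinfun_apply R' g)"
  show "R' = R"
  proof (rule blinfun_eqI, rule ell2_eqI)
    fix g x
    have "cinner (ell2_basis x) (blinfun_apply R' g) = cinner (ell2_basis x) (blinfun_apply R g)"
      using assms R' by metis
    then show "ell2_apply (blinfun_apply R' g) x = ell2_apply (blinfun_apply R g) x"
      by (simp add: cinner_ell2_basis)
  qed
qed (use assms in blast)

text \<open>The strong operator topology is the pullback of the product topology along
  \<open>blinfun_apply\<close>, and convergence in a product topology is pointwise.\<close>

lemma limitin_strong_operator_topology_iff: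
  "limitin strong_operator_topology T A F \<longleftrightarrow>
     (\<forall>f. ((\<lambda>n. blinfun_apply (T n) f) \<longlongrightarrow> blinfun_apply A f) F)"
proof
  assume "limitin strong_operator_topology T A F"
  then show "\<forall>f. ((\<lambda>n. blinfun_apply (T n) f) \<longlongrightarrow> blinfun_apply A f) F"
    using continuous_map_limit[OF strong_operator_topology_continuous_evaluation]
    by (fastforce simp: o_def)
next
  assume lim: "\<forall>f. ((\<lambda>n. blinfun_apply (T n) f) \<longlongrightarrow> blinfun_apply A f) F"
  then have lim: "((\<lambda>n. blinfun_apply (T n)) \<longlongrightarrow> blinfun_apply A) F"
    by (simp add: limitin_componentwise flip: limitin_canonical_iff euclidean_product_topology)
  show "limitin strong_operator_topology T A F"
    unfolding limitin_def strong_operator_topology_topspace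
  proof (intro conjI allI impI, goal_cases)
    case (2 U)
    then obtain V where "open V" "U = blinfun_apply -` V"
      by (auto simp: strong_operator_topology_def openin_pullback_topology)
    with 2 topological_tendstoD[OF lim, of V] show ?case
      by auto
  qed simp
qed

lemma asymptotic_limit_eqI:
  assumes "\<And>f. (\<lambda>n. blinfun_apply (op_power (adjoint_op T) n o\<^sub>L op_power T n) f)
      \<longlonglongrightarrow> blinfun_apply A f"
  shows "asymptotic_limit T = A"
  unfolding asymptotic_limit_def limitin_strong_operator_topology_iff
proof (rule the_equality)
  show "B = A"
    if "\<forall>f. (\<lambda>n. blinfun_apply (op_power (adjoint_op T) n o\<^sub>L op_power T n) f)
      \<longlonglongrightarrow> blinfun_apply B f" for B
    using LIMSEQ_unique[OF that[THEN spec] assms] by (rule blinfun_eqI)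
qed (use assms in blast)

text \<open>The recursion adds factors on the left; peeling one off on the right exposes the
  innermost shift in \<open>S*^n S^n\<close>.\<close>

lemma op_power_Suc_right: "op_power T (Suc n) = op_power T n o\<^sub>L T"
proof (induction n)
  case (Suc n)
  show ?case
  proof (rule blinfun_eqI)
    fix f
    have "blinfun_apply (op_power T (Suc (Suc n))) f
        = blinfun_apply T (blinfun_apply (op_power T (Suc n)) f)"
      by simp
    also have "\<dots> = blinfun_apply T (blinfun_apply (op_power T n) (blinfun_apply T f))"
      unfolding Suc.IH by simp
    finally show "blinfun_apply (op_power T (Suc (Suc n))) f
        = blinfun_apply (op_power T (Suc n) o\<^sub>L T) f"
      by simp
  qed
qed (auto intro: blinfun_eqI)


section \<open>Weighted shifts\<close>

text \<open>The working form of the hypotheses: unique parents make the child sets disjoint, and the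
  extended-real supremum is replaced by real summability with a uniform bound
  \<open>C\<close>.\<close>

locale weighted_forest =
  fixes E :: "('v \<times> 'v) set" and lam :: "'v \<Rightarrow> real" and C :: real
  assumes parent_unique: "(u, v) \<in> E \<Longrightarrow> (u', v) \<in> E \<Longrightarrow> u = u'"
    and lam_summable: "(\<lambda>v. (lam v)\<^sup>2) summable_on Chi E u"
    and lam_bound: "(\<Sum>\<^sub>\<infinity>v\<in>Chi E u. (lam v)\<^sup>2) \<le> C"
begin

lemma par_eq: "v \<in> Chi E u \<Longrightarrow> par E v = u"
  unfolding par_def Chi_def using parent_unique by blast

text \<open>True at a root whatever the unspecified value of \<open>par\<close> is there, because a
  root is a child of no vertex.\<close>

lemma non_roots_iff: "v \<in> non_roots E \<longleftrightarrow> v \<in> Chi E (par E v)"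
  using par_eq by (fastforce simp: non_roots_def is_root_def Chi_def)

lemma Chi_iff: "v \<in> Chi E u \<longleftrightarrow> v \<in> non_roots E \<and> par E v = u"
  using par_eq non_roots_iff by (auto simp: non_roots_def is_root_def Chi_def)

lemma C_nonneg: "0 \<le> C"
  using lam_bound infsum_nonneg[of "Chi E u" "\<lambda>v. (lam v)\<^sup>2" for u] by (meson order_trans zero_le_power2)

text \<open>Every non-root is the endpoint of exactly one edge. Sums over non-roots can therefore be
  regrouped by parent.\<close>

lemma bij_betw_edges: "bij_betw snd (Sigma UNIV (Chi E)) (non_roots E)"
  by (auto simp: bij_betw_def inj_on_def Chi_iff image_iff)

lemma summable_on_edges:
  "(\<lambda>(u, v). h v) summable_on Sigma UNIV (Chi E) \<longleftrightarrow> h summable_on non_roots E"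
  using summable_on_reindex_bij_betw[OF bij_betw_edges, of h] by (simp add: case_prod_unfold)

lemma infsum_edges:
  fixes h :: "'v \<Rightarrow> 'b :: banach"
  assumes "h summable_on non_roots E"
  shows "(\<Sum>\<^sub>\<infinity>v\<in>non_roots E. h v) = (\<Sum>\<^sub>\<infinity>u. \<Sum>\<^sub>\<infinity>v\<in>Chi E u. h v)"
proof -
  have "(\<Sum>\<^sub>\<infinity>v\<in>non_roots E. h v) = (\<Sum>\<^sub>\<infinity>(u, v)\<in>Sigma UNIV (Chi E). h v)"
    using infsum_reindex_bij_betw[OF bij_betw_edges, of h] by (simp add: case_prod_unfold)
  also have "\<dots> = (\<Sum>\<^sub>\<infinity>u. \<Sum>\<^sub>\<infinity>v\<in>Chi E u. h v)"
    using assms by (subst infsum_Sigma_banach[symmetric]) (auto simp: summable_on_edges)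
  finally show ?thesis .
qed

section \<open>Coordinate formulas for the shift and its adjoint\<close>

definition shift_fun :: "'v ell2 \<Rightarrow> 'v \<Rightarrow> complex" where
  "shift_fun f v = (if v \<in> non_roots E then of_real (lam v) * ell2_apply f (par E v) else 0)"

definition backshift_fun :: "'v ell2 \<Rightarrow> 'v \<Rightarrow> complex" where
  "backshift_fun g u = (\<Sum>\<^sub>\<infinity>v\<in>Chi E u. of_real (lam v) * ell2_apply g v)"

text \<open>After regrouping by parent, the squared modulus of \<open>f\<close> at \<open>u\<close>
  is multiplied by the sum of the squared weights of the children of \<open>u\<close>, which is at
  most \<open>C\<close>. A root contributes nothing, since \<open>shift_fun\<close> is 0
  there.\<close>

lemma ex_shift: "\<exists>S :: 'v operator. \<forall>f x. ell2_apply (blinfun_apply S f) x = shift_fun f x"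
proof (rule ex_operator)
  fix f :: "'v ell2"
  let ?h = "\<lambda>v. (lam v)\<^sup>2 * (cmod (ell2_apply f (par E v)))\<^sup>2"
  have inner_sum: "(\<Sum>\<^sub>\<infinity>v\<in>Chi E u. ?h v) = (\<Sum>\<^sub>\<infinity>v\<in>Chi E u. (lam v)\<^sup>2) * (cmod (ell2_apply f u))\<^sup>2" for u
    unfolding infsum_cmult_left'[symmetric] by (rule infsum_cong) (simp add: par_eq)
  have le: "(\<Sum>\<^sub>\<infinity>v\<in>Chi E u. ?h v) \<le> C * (cmod (ell2_apply f u))\<^sup>2" for u
    unfolding inner_sum by (intro mult_right_mono lam_bound) simp
  have outer: "(\<lambda>u. \<Sum>\<^sub>\<infinity>v\<in>Chi E u. ?h v) summable_on UNIV"
    by (rule summable_on_comparison_test[OF summable_on_cmult_right[OF ell2_square_summable] le])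
      (auto intro: infsum_nonneg)
  have "(\<lambda>(u, v). ?h v) summable_on Sigma UNIV (Chi E)"
  proof (rule summable_on_SigmaI[OF _ outer])
    fix u
    have "?h summable_on Chi E u \<longleftrightarrow> (\<lambda>v. (lam v)\<^sup>2 * (cmod (ell2_apply f u))\<^sup>2) summable_on Chi E u"
      by (rule summable_on_cong) (simp add: par_eq)
    then show "((\<lambda>v. case (u, v) of (u, v) \<Rightarrow> ?h v) has_sum (\<Sum>\<^sub>\<infinity>v\<in>Chi E u. ?h v)) (Chi E u)"
      using lam_summable by (auto intro!: has_sum_infsum summable_on_cmult_left)
  qed auto
  then have h_sm: "?h summable_on non_roots E"
    by (simp add: summable_on_edges)
  have "(\<lambda>x. (cmod (shift_fun f x))\<^sup>2) summable_on UNIV \<longleftrightarrow> ?h summable_on non_roots E"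
    by (rule summable_on_cong_neutral) (auto simp: shift_fun_def norm_mult power_mult_distrib)
  with h_sm show "(\<lambda>x. (cmod (shift_fun f x))\<^sup>2) summable_on UNIV"
    by simp
  have "(\<Sum>\<^sub>\<infinity>x. (cmod (shift_fun f x))\<^sup>2) = (\<Sum>\<^sub>\<infinity>v\<in>non_roots E. ?h v)"
    by (rule infsum_cong_neutral) (auto simp: shift_fun_def norm_mult power_mult_distrib)
  also have "\<dots> = (\<Sum>\<^sub>\<infinity>u. \<Sum>\<^sub>\<infinity>v\<in>Chi E u. ?h v)"
    by (rule infsum_edges[OF h_sm])
  also have "\<dots> \<le> (\<Sum>\<^sub>\<infinity>u. C * (cmod (ell2_apply f u))\<^sup>2)"
    by (intro infsum_mono outer le summable_on_cmult_right ell2_square_summable)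
  also have "\<dots> = C * (norm f)\<^sup>2"
    by (simp add: norm_ell2_sq infsum_cmult_right')
  finally show "(\<Sum>\<^sub>\<infinity>x. (cmod (shift_fun f x))\<^sup>2) \<le> C * (norm f)\<^sup>2" .
qed (auto simp: shift_fun_def plus_ell2.rep_eq scaleR_ell2.rep_eq algebra_simps)

lemma weighted_shift_apply:
  "ell2_apply (blinfun_apply (weighted_shift E lam) f) x = shift_fun f x"
proof -
  obtain S :: "'v operator" where S: "\<And>f x. ell2_apply (blinfun_apply S f) x = shift_fun f x"
    using ex_shift by blast
  have lin: "complex_linear S"
    unfolding complex_linear_def
    by (intro allI ell2_eqI) (simp add: S scaleC.rep_eq shift_fun_def)
  have basis: "blinfun_apply S (ell2_basis u) = (\<Sum>\<^sub>\<infinity>v\<in>Chi E u. lam v *\<^sub>R ell2_basis v)" for u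
  proof -
    have eq: "ell2_apply (blinfun_apply S (ell2_basis u)) v = (if v \<in> Chi E u then lam v else 0)" for v
      by (simp add: S shift_fun_def ell2_basis.rep_eq Chi_iff)
    \<comment> \<open>The coordinates of the image vanish off the children of \<open>u\<close>, so
      its basis expansion over all vertices shrinks to a sum over \<open>Chi E u\<close>.\<close>
    have "((\<lambda>v. lam v *\<^sub>R ell2_basis v) has_sum blinfun_apply S (ell2_basis u)) (Chi E u)"
      using ell2_basis_has_sum[of "blinfun_apply S (ell2_basis u)"]
      by (rule has_sum_cong_neutral[THEN iffD1, rotated -1])
        (auto simp: eq intro!: ell2_eqI simp: scaleC.rep_eq scaleR_ell2.rep_eq zero_ell2.rep_eq)
    then show ?thesis
      by (simp add: infsumI)
  qed
  have "weighted_shift E lam = S"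
    unfolding weighted_shift_def
  proof (rule the_equality)
    fix S' :: "'v operator"
    assume "complex_linear S' \<and>
      (\<forall>u. blinfun_apply S' (ell2_basis u) = (\<Sum>\<^sub>\<infinity>v\<in>Chi E u. lam v *\<^sub>R ell2_basis v))"
    then show "S' = S"
      using lin basis by (intro complex_linear_eqI_basis) auto
  qed (use lin basis in blast)
  then show ?thesis
    by (simp add: S)
qed

lemma backshift_abs_summable:
  "(\<lambda>v. cmod (of_real (lam v) * ell2_apply g v)) summable_on Chi E u"
  unfolding norm_mult norm_of_real
  by (rule infsum_mult_sq_le(1)) (use lam_summable ell2_square_summable in auto)

text \<open>At each vertex, Cauchy-Schwarz bounds the squared value by \<open>C\<close> times the
  mass of \<open>g\<close> on the children. Child sets are disjoint, so these masses add up to at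
  most the squared norm of \<open>g\<close>.\<close>

lemma ex_backshift:
  "\<exists>R :: 'v operator. \<forall>g x. ell2_apply (blinfun_apply R g) x = backshift_fun g x"
proof (rule ex_operator)
  fix f g :: "'v ell2" and x
  show "backshift_fun (f + g) x = backshift_fun f x + backshift_fun g x"
    unfolding backshift_fun_def plus_ell2.rep_eq distrib_left
    by (rule infsum_add) (rule abs_summable_summable[OF backshift_abs_summable])+
  show "backshift_fun (r *\<^sub>R f) x = of_real r * backshift_fun f x" for r
    by (simp add: backshift_fun_def scaleR_ell2.rep_eq mult.left_commute[of _ "of_real r"]
        infsum_cmult_right')
next
  fix g :: "'v ell2"
  let ?h = "\<lambda>v. (cmod (ell2_apply g v))\<^sup>2"
  have le: "(cmod (backshift_fun g u))\<^sup>2 \<le> C * (\<Sum>\<^sub>\<infinity>v\<in>Chi E u. ?h v)" for u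
  proof -
    have "cmod (backshift_fun g u) \<le> (\<Sum>\<^sub>\<infinity>v\<in>Chi E u. cmod (of_real (lam v) * ell2_apply g v))"
      unfolding backshift_fun_def by (intro norm_infsum_bound backshift_abs_summable)
    then have "(cmod (backshift_fun g u))\<^sup>2 \<le> (\<Sum>\<^sub>\<infinity>v\<in>Chi E u. \<bar>lam v\<bar> * cmod (ell2_apply g v))\<^sup>2"
      by (intro power_mono) (auto simp: norm_mult)
    also have "\<dots> \<le> (\<Sum>\<^sub>\<infinity>v\<in>Chi E u. \<bar>lam v\<bar>\<^sup>2) * (\<Sum>\<^sub>\<infinity>v\<in>Chi E u. ?h v)"
      by (rule infsum_mult_sq_le(2)) (use lam_summable ell2_square_summable in auto)
    also have "\<dots> \<le> C * (\<Sum>\<^sub>\<infinity>v\<in>Chi E u. ?h v)"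
      using lam_bound by (intro mult_right_mono infsum_nonneg) auto
    finally show ?thesis .
  qed
  have "(\<lambda>(u, v). ?h v) summable_on Sigma UNIV (Chi E)"
    by (simp add: summable_on_edges ell2_square_summable)
  from summable_on_Sigma_banach[OF this]
  have outer: "(\<lambda>u. \<Sum>\<^sub>\<infinity>v\<in>Chi E u. ?h v) summable_on UNIV"
    by simp
  show sm: "(\<lambda>x. (cmod (backshift_fun g x))\<^sup>2) summable_on UNIV"
    by (rule summable_on_comparison_test[OF summable_on_cmult_right[OF outer] le]) auto
  have "(\<Sum>\<^sub>\<infinity>x. (cmod (backshift_fun g x))\<^sup>2) \<le> (\<Sum>\<^sub>\<infinity>u. C * (\<Sum>\<^sub>\<infinity>v\<in>Chi E u. ?h v))"
    by (intro infsum_mono sm summable_on_cmult_right outer le)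
  also have "\<dots> = C * (\<Sum>\<^sub>\<infinity>v\<in>non_roots E. ?h v)"
    by (simp add: infsum_cmult_right' infsum_edges ell2_square_summable)
  also have "\<dots> \<le> C * (norm g)\<^sup>2"
    unfolding norm_ell2_sq
    by (intro mult_left_mono C_nonneg infsum_mono2 ell2_square_summable) auto
  finally show "(\<Sum>\<^sub>\<infinity>x. (cmod (backshift_fun g x))\<^sup>2) \<le> C * (norm g)\<^sup>2" .
qed

text \<open>Grouping the inner product by parent, the value of \<open>f\<close> at \<open>u\<close>
  is a common factor over the children of \<open>u\<close>; the weights are real, so the remaining
  sum is the conjugate of \<open>backshift_fun g u\<close>.\<close>

lemma adjoint_weighted_shift_apply:
  "ell2_apply (blinfun_apply (adjoint_op (weighted_shift E lam)) g) x = backshift_fun g x"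
proof -
  obtain R :: "'v operator" where R: "\<And>f x. ell2_apply (blinfun_apply R f) x = backshift_fun f x"
    using ex_backshift by blast
  let ?S = "weighted_shift E lam"
  have "cinner (blinfun_apply ?S f) g = cinner f (blinfun_apply R g)" for f g
  proof -
    let ?h = "\<lambda>v. ell2_apply (blinfun_apply ?S f) v * cnj (ell2_apply g v)"
    have "?h summable_on UNIV"
      using ell2_summable_mult ell2_apply by blast
    then have sm: "?h summable_on non_roots E"
      by (rule summable_on_subset_banach) simp
    have "cinner (blinfun_apply ?S f) g = (\<Sum>\<^sub>\<infinity>v\<in>non_roots E. ?h v)"
      unfolding cinner_def
      by (rule infsum_cong_neutral) (auto simp: weighted_shift_apply shift_fun_def)
    also have "\<dots> = (\<Sum>\<^sub>\<infinity>u. \<Sum>\<^sub>\<infinity>v\<in>Chi E u. ?h v)"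
      by (rule infsum_edges[OF sm])
    also have "\<dots> = (\<Sum>\<^sub>\<infinity>u. ell2_apply f u * cnj (backshift_fun g u))"
    proof (rule infsum_cong)
      fix u
      have "(\<Sum>\<^sub>\<infinity>v\<in>Chi E u. ?h v)
          = (\<Sum>\<^sub>\<infinity>v\<in>Chi E u. ell2_apply f u * cnj (of_real (lam v) * ell2_apply g v))"
        by (rule infsum_cong) (simp add: weighted_shift_apply shift_fun_def Chi_iff)
      also have "\<dots> = ell2_apply f u * cnj (backshift_fun g u)"
        unfolding backshift_fun_def infsum_cmult_right' infsum_cnj ..
      finally show "(\<Sum>\<^sub>\<infinity>v\<in>Chi E u. ?h v) = ell2_apply f u * cnj (backshift_fun g u)" .
    qed
    finally show ?thesis
      by (simp add: cinner_def R)
  qed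
  then have "adjoint_op ?S = R"
    by (rule adjoint_op_eqI)
  then show ?thesis
    by (simp add: R)
qed

text \<open>The shift sends the single value of \<open>f\<close> at \<open>u\<close> to all children
  of \<open>u\<close>, and the adjoint collects from exactly those children. Each weight is met
  twice, and no other coordinate of \<open>f\<close> enters.\<close>

lemma diagonal_conjugate:
  assumes "diagonal a D"
  shows "diagonal (\<lambda>u. \<Sum>\<^sub>\<infinity>v\<in>Chi E u. (lam v)\<^sup>2 * a v)
    (adjoint_op (weighted_shift E lam) o\<^sub>L D o\<^sub>L weighted_shift E lam)"
  unfolding diagonal_def
proof (intro allI)
  fix f u
  have "ell2_apply (blinfun_apply (adjoint_op (weighted_shift E lam) o\<^sub>L D o\<^sub>L weighted_shift E lam) f) u
      = (\<Sum>\<^sub>\<infinity>v\<in>Chi E u. of_real (lam v) * (of_real (a v) * shift_fun f v))"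
    using assms by (simp add: adjoint_weighted_shift_apply backshift_fun_def diagonal_def
        weighted_shift_apply)
  also have "\<dots> = (\<Sum>\<^sub>\<infinity>v\<in>Chi E u. of_real ((lam v)\<^sup>2 * a v) * ell2_apply f u)"
    by (rule infsum_cong) (simp add: shift_fun_def Chi_iff power2_eq_square)
  also have "\<dots> = of_real (\<Sum>\<^sub>\<infinity>v\<in>Chi E u. (lam v)\<^sup>2 * a v) * ell2_apply f u"
    by (simp only: infsum_cmult_left' infsum_complex_of_real)
  finally show "ell2_apply (blinfun_apply
      (adjoint_op (weighted_shift E lam) o\<^sub>L D o\<^sub>L weighted_shift E lam) f) u
      = of_real (\<Sum>\<^sub>\<infinity>v\<in>Chi E u. (lam v)\<^sup>2 * a v) * ell2_apply f u" .
qed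

section \<open>Path sums and their recursion\<close>

lemma Chi_n_Suc: "Chi_n E (Suc n) u = (\<Union>v\<in>Chi E u. Chi_n E n v)"
proof -
  \<comment> \<open>Taking children commutes with unions, which lets descendants be sorted by the
    first vertex after \<open>u\<close> instead of by their last generation.\<close>
  have "(Chi_set E ^^ n) W = (\<Union>v\<in>W. (Chi_set E ^^ n) {v})" for W
    by (induction n) (auto simp: Chi_set_def)
  then show ?thesis
    unfolding Chi_n_def funpow_Suc_right o_apply by (metis Chi_set_def UN_insert UN_empty Un_empty_right)
qed

lemma par_funpow_Chi_n: "w \<in> Chi_n E n u \<Longrightarrow> (par E ^^ n) w = u"
proof (induction n arbitrary: u)
  case (Suc n)
  then obtain v where "v \<in> Chi E u" "w \<in> Chi_n E n v"
    by (auto simp: Chi_n_Suc)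
  with Suc.IH show ?case
    by (simp add: par_eq)
qed (simp add: Chi_n_def)

text \<open>The factor with index \<open>n\<close> is the weight at the \<open>n\<close>-th ancestor
  of \<open>w\<close>, which is \<open>v\<close>.\<close>

lemma path_weight_sq_Suc:
  "w \<in> Chi_n E n v \<Longrightarrow> path_weight_sq E lam (Suc n) w = (lam v)\<^sup>2 * path_weight_sq E lam n w"
  by (simp add: path_weight_sq_def par_funpow_Chi_n mult.commute)

lemma path_weight_sq_nonneg: "0 \<le> path_weight_sq E lam n v"
  by (simp add: path_weight_sq_def prod_nonneg)

definition path_sum :: "nat \<Rightarrow> 'v \<Rightarrow> real" where
  "path_sum n u = (\<Sum>\<^sub>\<infinity>v\<in>Chi_n E n u. path_weight_sq E lam n v)"

lemma path_sum_nonneg: "0 \<le> path_sum n u"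
  unfolding path_sum_def by (intro infsum_nonneg path_weight_sq_nonneg)

lemma path_sum_0: "path_sum 0 u = 1"
  by (simp add: path_sum_def Chi_n_def path_weight_sq_def)

text \<open>Descendants of different children are disjoint, because the \<open>n\<close>-th ancestor
  recovers the child; nonnegativity then permits summing child by child. The \<open>has_sum\<close>
  form supplies both summability and the value.\<close>

lemma path_weight_has_sum_Suc:
  assumes sm: "\<And>v. path_weight_sq E lam n summable_on Chi_n E n v"
    and outer: "(\<lambda>v. (lam v)\<^sup>2 * path_sum n v) summable_on Chi E u"
  shows "(path_weight_sq E lam (Suc n) has_sum (\<Sum>\<^sub>\<infinity>v\<in>Chi E u. (lam v)\<^sup>2 * path_sum n v))
    (Chi_n E (Suc n) u)"
proof -
  have bij: "bij_betw snd (Sigma (Chi E u) (Chi_n E n)) (Chi_n E (Suc n) u)"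
  proof (rule bij_betw_imageI)
    show "inj_on snd (Sigma (Chi E u) (Chi_n E n))"
      by (auto simp: inj_on_def dest!: par_funpow_Chi_n)
    show "snd ` Sigma (Chi E u) (Chi_n E n) = Chi_n E (Suc n) u"
      by (simp add: Chi_n_Suc snd_image_Sigma)
  qed
  have inner_sum: "((\<lambda>w. path_weight_sq E lam (Suc n) (snd (v, w))) has_sum (lam v)\<^sup>2 * path_sum n v)
      (Chi_n E n v)" for v
    using has_sum_cmult_right[OF has_sum_infsum[OF sm[of v]], of "(lam v)\<^sup>2"]
    unfolding path_sum_def by (simp add: path_weight_sq_Suc cong: has_sum_cong)
  have "((\<lambda>p. path_weight_sq E lam (Suc n) (snd p)) has_sum
      (\<Sum>\<^sub>\<infinity>v\<in>Chi E u. (lam v)\<^sup>2 * path_sum n v)) (Sigma (Chi E u) (Chi_n E n))"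
    by (rule has_sum_SigmaI[OF inner_sum has_sum_infsum[OF outer]
        summable_on_SigmaI[OF inner_sum outer path_weight_sq_nonneg]])
  then show ?thesis
    by (simp only: has_sum_reindex_bij_betw[OF bij])
qed

section \<open>Consequences of contractivity\<close>

lemma norm_weighted_shift_basis:
  "(norm (blinfun_apply (weighted_shift E lam) (ell2_basis u)))\<^sup>2 = (\<Sum>\<^sub>\<infinity>v\<in>Chi E u. (lam v)\<^sup>2)"
  unfolding norm_ell2_sq
  by (rule infsum_cong_neutral)
    (auto simp: weighted_shift_apply shift_fun_def ell2_basis.rep_eq Chi_iff)

text \<open>Contractivity is tested on the unit vector \<open>ell2_basis u\<close>.\<close>

lemma sum_lam_sq_le_1:
  assumes "contraction (weighted_shift E lam)"
  shows "(\<Sum>\<^sub>\<infinity>v\<in>Chi E u. (lam v)\<^sup>2) \<le> 1"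
proof -
  have "(norm (ell2_basis u))\<^sup>2 = (\<Sum>\<^sub>\<infinity>x\<in>{u}. 1 :: real)"
    unfolding norm_ell2_sq by (rule infsum_cong_neutral) (auto simp: ell2_basis.rep_eq)
  then have "norm (ell2_basis u) = 1"
    using norm_ge_zero[of "ell2_basis u"] by (auto simp: power2_eq_1_iff simp del: norm_ge_zero)
  then have "norm (blinfun_apply (weighted_shift E lam) (ell2_basis u)) \<le> 1"
    using norm_blinfun[of "weighted_shift E lam" "ell2_basis u"] assms
    by (simp add: contraction_def)
  then show ?thesis
    by (metis norm_weighted_shift_basis norm_ge_zero power_le_one)
qed

text \<open>The claims are proved by one induction because they feed each other: the bound by 1
  makes the outer sum summable by comparison with the squared weights, this gives summability and
  the recursion one level down the tree, and the recursion preserves monotonicity, which in turn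
  gives the next bound.\<close>

lemma path_weight_summable:
  assumes le_1: "\<And>u. (\<Sum>\<^sub>\<infinity>v\<in>Chi E u. (lam v)\<^sup>2) \<le> 1"
  shows "path_weight_sq E lam n summable_on Chi_n E n u"
    and path_sum_Suc: "path_sum (Suc n) u = (\<Sum>\<^sub>\<infinity>v\<in>Chi E u. (lam v)\<^sup>2 * path_sum n v)"
    and path_sum_decreasing: "path_sum (Suc n) u \<le> path_sum n u"
    and path_sum_le_1: "path_sum n u \<le> 1"
proof -
  have outer: "(\<lambda>v. (lam v)\<^sup>2 * path_sum n v) summable_on Chi E u"
    if "\<And>v. path_sum n v \<le> 1" for n u
    by (rule summable_on_comparison_test[OF lam_summable])
      (use that path_sum_nonneg in \<open>auto simp: mult_left_le\<close>)
  have main: "(\<forall>u. path_weight_sq E lam n summable_on Chi_n E n u) \<and> (\<forall>u. path_sum n u \<le> 1) \<and>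
      (\<forall>u. path_sum (Suc n) u \<le> path_sum n u)" for n
  proof (induction n)
    case 0
    have sm: "path_weight_sq E lam 0 summable_on Chi_n E 0 v" for v
      by (simp add: Chi_n_def)
    have "path_sum (Suc 0) u = (\<Sum>\<^sub>\<infinity>v\<in>Chi E u. (lam v)\<^sup>2)" for u
      using infsumI[OF path_weight_has_sum_Suc[OF sm outer, of u]]
      by (simp add: path_sum_0 path_sum_def[of "Suc 0"])
    with le_1 sm show ?case
      by (simp add: path_sum_0)
  next
    case (Suc n)
    have hs: "(path_weight_sq E lam (Suc n) has_sum (\<Sum>\<^sub>\<infinity>v\<in>Chi E u. (lam v)\<^sup>2 * path_sum n v))
        (Chi_n E (Suc n) u)" for u
      using Suc by (intro path_weight_has_sum_Suc outer) auto
    have sm: "path_weight_sq E lam (Suc n) summable_on Chi_n E (Suc n) u" for u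
      using hs by (auto simp: summable_on_def)
    have le: "path_sum (Suc n) u \<le> 1" for u
      using Suc order_trans by blast
    have hs': "(path_weight_sq E lam (Suc (Suc n)) has_sum
        (\<Sum>\<^sub>\<infinity>v\<in>Chi E u. (lam v)\<^sup>2 * path_sum (Suc n) v)) (Chi_n E (Suc (Suc n)) u)" for u
      by (intro path_weight_has_sum_Suc outer sm le)
    have "path_sum (Suc (Suc n)) u \<le> path_sum (Suc n) u" for u
      unfolding path_sum_def[of "Suc n" u] path_sum_def[of "Suc (Suc n)"]
        infsumI[OF hs] infsumI[OF hs']
      using Suc le by (intro infsum_mono outer mult_left_mono) auto
    with sm le show ?case
      by blast
  qed
  from main show "path_weight_sq E lam n summable_on Chi_n E n u" "path_sum n u \<le> 1"
    "path_sum (Suc n) u \<le> path_sum n u"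
    by blast+
  show "path_sum (Suc n) u = (\<Sum>\<^sub>\<infinity>v\<in>Chi E u. (lam v)\<^sup>2 * path_sum n v)"
    unfolding path_sum_def[of "Suc n"]
    using main by (intro infsumI path_weight_has_sum_Suc outer) auto
qed

lemma diagonal_power:
  assumes "\<And>u. (\<Sum>\<^sub>\<infinity>v\<in>Chi E u. (lam v)\<^sup>2) \<le> 1"
  shows "diagonal (path_sum n)
    (op_power (adjoint_op (weighted_shift E lam)) n o\<^sub>L op_power (weighted_shift E lam) n)"
proof (induction n)
  case 0
  show ?case
    by (simp add: diagonal_def path_sum_0)
next
  case (Suc n)
  let ?S = "weighted_shift E lam"
  \<comment> \<open>The adjoint is peeled off on the outside and the shift on the inside, leaving
    the level \<open>n\<close> operator in the middle for \<open>diagonal_conjugate\<close>.\<close>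
  have "op_power (adjoint_op ?S) (Suc n) o\<^sub>L op_power ?S (Suc n)
      = adjoint_op ?S o\<^sub>L (op_power (adjoint_op ?S) n o\<^sub>L op_power ?S n) o\<^sub>L ?S"
    unfolding op_power_Suc_right[of ?S] by (auto intro!: blinfun_eqI)
  with diagonal_conjugate[OF Suc] show ?case
    by (simp add: path_sum_Suc[OF assms, abs_def] fun_eq_iff diagonal_def)
qed

end

section \<open>From admissible weights to the theorem\<close>

lemma admissible_weights_imp_weighted_forest:
  assumes "directed_tree E" and "admissible_weights E lam"
  shows "\<exists>C. weighted_forest E lam C"
proof -
  define B where "B = (SUP u. \<Sum>\<^sub>\<infinity>v\<in>Chi E u. ennreal ((lam v)\<^sup>2))"
  have B: "B < \<infinity>"
    using assms(2) by (simp add: admissible_weights_def B_def)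
  \<comment> \<open>Real summability is not yet known, so finite partial sums are compared with the
    supremum in \<open>ennreal\<close>, where every family is summable; finiteness of
    \<open>B\<close> brings the bound back to the reals.\<close>
  have fin: "(\<Sum>v\<in>F. (lam v)\<^sup>2) \<le> enn2real B" if "finite F" "F \<subseteq> Chi E u" for F u
  proof -
    have "ennreal (\<Sum>v\<in>F. (lam v)\<^sup>2) = (\<Sum>v\<in>F. ennreal ((lam v)\<^sup>2))"
      by simp
    also have "\<dots> = (\<Sum>\<^sub>\<infinity>v\<in>F. ennreal ((lam v)\<^sup>2))"
      using that by simp
    also have "\<dots> \<le> (\<Sum>\<^sub>\<infinity>v\<in>Chi E u. ennreal ((lam v)\<^sup>2))"
      using that by (intro infsum_mono_neutral nonneg_summable_on_complete) auto
    also have "\<dots> \<le> B"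
      unfolding B_def by (rule SUP_upper) simp
    finally have "enn2real (ennreal (\<Sum>v\<in>F. (lam v)\<^sup>2)) \<le> enn2real B"
      using B by (intro enn2real_mono) auto
    then show ?thesis
      by (simp add: sum_nonneg)
  qed
  have sm: "(\<lambda>v. (lam v)\<^sup>2) summable_on Chi E u" for u
    by (rule nonneg_bdd_above_summable_on) (auto intro!: bdd_aboveI[of _ "enn2real B"] fin)
  have "weighted_forest E lam (enn2real B)"
  proof
    show "u = u'" if "(u, v) \<in> E" "(u', v) \<in> E" for u u' v
      using that assms(1) unfolding directed_tree_def by blast
    show "(\<lambda>v. (lam v)\<^sup>2) summable_on Chi E u" for u
      by (rule sm)
    show "(\<Sum>\<^sub>\<infinity>v\<in>Chi E u. (lam v)\<^sup>2) \<le> enn2real B" for u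
      by (rule infsum_le_finite_sums[OF sm fin])
  qed
  then show ?thesis ..
qed

theorem lemma3p1:
  fixes E :: "('v \<times> 'v) set" and lam :: "'v \<Rightarrow> real"
  assumes "directed_tree E"
    and "admissible_weights E lam"
    and "contraction (weighted_shift E lam)"
  shows "\<exists>\<alpha> :: 'v \<Rightarrow> real. \<forall>u.
    (\<forall>n. path_weight_sq E lam n summable_on Chi_n E n u) \<and>
    (\<lambda>n. \<Sum>\<^sub>\<infinity>v\<in>Chi_n E n u. path_weight_sq E lam n v) \<longlonglongrightarrow> \<alpha> u \<and>
    \<alpha> u \<in> {0..1} \<and>
    blinfun_apply (asymptotic_limit (weighted_shift E lam)) (ell2_basis u) = \<alpha> u *\<^sub>R ell2_basis u"
proof -
  obtain C where "weighted_forest E lam C"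
    using admissible_weights_imp_weighted_forest[OF assms(1,2)] by blast
  then interpret weighted_forest E lam C .
  note le_1 = sum_lam_sq_le_1[OF assms(3)]
  define \<alpha> where "\<alpha> u = lim (\<lambda>n. path_sum n u)" for u
  have lim: "(\<lambda>n. path_sum n u) \<longlonglongrightarrow> \<alpha> u" for u
  proof -
    have "decseq (\<lambda>n. path_sum n u)"
      by (rule decseq_SucI) (rule path_sum_decreasing[OF le_1])
    then obtain L where "(\<lambda>n. path_sum n u) \<longlonglongrightarrow> L"
      using decseq_convergent path_sum_nonneg by metis
    then show ?thesis
      unfolding \<alpha>_def by (simp add: limI)
  qed
  have range: "\<alpha> u \<in> {0..1}" for u
    using LIMSEQ_le_const[OF lim] LIMSEQ_le_const2[OF lim] path_sum_nonneg path_sum_le_1[OF le_1]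
    by auto
  have "\<bar>\<alpha> u\<bar> \<le> 1" for u
    using range[of u] by auto
  then obtain A where A: "diagonal \<alpha> A"
    using ex_diagonal by metis
  \<comment> \<open>Both numbers lie in the unit interval, so the constant 1 serves as the
    domination bound in \<open>diagonal_tendsto\<close>.\<close>
  have "\<bar>path_sum n u - \<alpha> u\<bar> \<le> 1" for n u
    using range[of u] path_sum_nonneg[of n u] path_sum_le_1[OF le_1, of n u] by auto
  then have "asymptotic_limit (weighted_shift E lam) = A"
    by (intro asymptotic_limit_eqI diagonal_tendsto[OF diagonal_power[OF le_1] A] lim)
  then show ?thesis
    using lim range path_weight_summable[OF le_1] diagonal_basis[OF A]
    by (intro exI[of _ \<alpha>]) (simp add: path_sum_def)
qed

end
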